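(* Let $k\ge 3$ be an integer and let $F$ be a $k$-graph on $m$ vertices which is not layered. Then $$\pi_{\mathrm{co}}(F)\ \ge\ q_{k,m}^{-q_{k,m}}\ >\ 0,\qquad\text{where}\qquad q_{k,m}=\frac{(k-1)^{m+1}-1}{k-2}.$$
   Context: A $k$-graph is a finite $k$-uniform hypergraph: a finite vertex set $V(F)$ together with a set $E(F)$ of $k$-element subsets of $V(F)$ called edges. A $k$-graph $H$ is $F$-free if it contains no (not necessarily induced) subhypergraph isomorphic to $F$. Layered: for a function $f:V(F)\to\mathbb N$ and $e\in E(F)$, let $f(e)$ denote the multiset $\{f(v):v\in e\}$ (with $k$ elements counted with multiplicity). The function $f$ is a layered function of $F$ if (A1) each edge $e$ has exactly one vertex whose label is the maximum within $e$ (i.e. the maximum of $f(e)$ has multiplicity one); and (A2) if $e,e'\in E(F)$ satisfy $\max f(e)=\max f(e')$, then $f(e)=f(e')$ as multisets. A $k$-graph is layered if it has a layered function. Codegree Turán density: for a $k$-graph $H$ and $S\subseteq V(H)$, $d_H(S)$ is the number of edges of $H$ containing $S$. The minimum codegree $\delta_{\mathrm{co}}(H)$ is the minimum of $d_H(S)$ over all $(k-1)$-subsets $S$ of $V(H)$. The codegree Turán number $\mathrm{ex}_{\mathrm{co}}(n,F)$ is the largest value of $\delta_{\mathrm{co}}(H)$ among all $n$-vertex $F$-free $k$-graphs $H$, and $$\pi_{\mathrm{co}}(F)=\lim_{n\to\infty}\frac{\mathrm{ex}_{\mathrm{co}}(n,F)}{n};$$ it is known that this limit always exists. *)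

theory Defs
  imports "HOL-Analysis.Analysis" "HOL-Library.Multiset"
begin

type_synonym 'a hypergraph = "'a set \<times> 'a set set"

definition verts :: "'a hypergraph \<Rightarrow> 'a set" where
  "verts H = fst H"

definition edges :: "'a hypergraph \<Rightarrow> 'a set set" where
  "edges H = snd H"

definition k_graph :: "nat \<Rightarrow> 'a hypergraph \<Rightarrow> bool" where
  "k_graph k H \<longleftrightarrow> finite (verts H) \<and> (\<forall>e\<in>edges H. e \<subseteq> verts H \<and> card e = k)"

definition hg_iso :: "'a hypergraph \<Rightarrow> 'b hypergraph \<Rightarrow> bool" where
  "hg_iso F G \<longleftrightarrow> (\<exists>\<phi>. bij_betw \<phi> (verts F) (verts G) \<and> (\<lambda>e. \<phi> ` e) ` edges F = edges G)"

definition subhypergraph :: "'a hypergraph \<Rightarrow> 'a hypergraph \<Rightarrow> bool" where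
  "subhypergraph G H \<longleftrightarrow>
     verts G \<subseteq> verts H \<and> edges G \<subseteq> edges H \<and> (\<forall>e\<in>edges G. e \<subseteq> verts G)"

definition free_of :: "'a hypergraph \<Rightarrow> 'b hypergraph \<Rightarrow> bool" where
  "free_of F H \<longleftrightarrow> \<not> (\<exists>G. subhypergraph G H \<and> hg_iso F G)"

definition labels :: "('a \<Rightarrow> nat) \<Rightarrow> 'a set \<Rightarrow> nat multiset" where
  "labels f e = image_mset f (mset_set e)"

definition layered_function :: "'a hypergraph \<Rightarrow> ('a \<Rightarrow> nat) \<Rightarrow> bool" where
  "layered_function F f \<longleftrightarrow>
     (\<forall>e\<in>edges F. \<exists>!v. v \<in> e \<and> f v = Max_mset (labels f e)) \<and>
     (\<forall>e\<in>edges F. \<forall>e'\<in>edges F.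
        Max_mset (labels f e) = Max_mset (labels f e') \<longrightarrow> labels f e = labels f e')"

definition layered :: "'a hypergraph \<Rightarrow> bool" where
  "layered F \<longleftrightarrow> (\<exists>f. layered_function F f)"

definition hg_degree :: "'a hypergraph \<Rightarrow> 'a set \<Rightarrow> nat" where
  "hg_degree H S = card {e \<in> edges H. S \<subseteq> e}"

definition min_codegree :: "nat \<Rightarrow> 'a hypergraph \<Rightarrow> nat" where
  "min_codegree k H = Min {hg_degree H S | S. S \<subseteq> verts H \<and> card S = k - 1}"

text \<open>
  Host graphs have natural numbers as vertices, which loses nothing since they are finite.
  For fewer than \<open>k - 1\<close> vertices the minimum codegree, and hence the number below, is an
  unspecified natural number; this does not affect the limit in \<open>pi_co\<close>.
\<close>

definition ex_co :: "nat \<Rightarrow> nat \<Rightarrow> 'a hypergraph \<Rightarrow> nat" where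
  "ex_co k n F =
     Max {min_codegree k H | H :: nat hypergraph.
            k_graph k H \<and> card (verts H) = n \<and> free_of F H}"

definition pi_co :: "nat \<Rightarrow> 'a hypergraph \<Rightarrow> real" where
  "pi_co k F = lim (\<lambda>n. real (ex_co k n F) / real n)"

definition q_const :: "nat \<Rightarrow> nat \<Rightarrow> real" where
  "q_const k m = ((real k - 1) ^ (m + 1) - 1) / (real k - 2)"

end

theory Submission
  imports Defs "HOL-Real_Asymp.Real_Asymp"
begin

text \<open>
  Label the vertices of the host by functions from the \<open>q\<close> nodes of the \<open>(k - 1)\<close>-ary tree of depth
  \<open>m\<close> to \<open>q\<close> colours, each of the \<open>q ^ q\<close> labels on an equal share of the vertices. A vertex \<open>v\<close> and a
  \<open>(k - 1)\<close>-set form an edge when the subtrees below the root of the label of \<open>v\<close> are the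
  truncated labels of the vertices of the set and the root colour of \<open>v\<close> occurs nowhere else in its
  label. Such a label exists for every set, since the other \<open>q - 1\<close> nodes leave a colour for the root.

  Given \<open>m\<close> vertices of this host, partition them by their labels truncated at depth \<open>j\<close>. For the least
  \<open>j\<close> such that there are at most \<open>j\<close> classes, the depths \<open>j - 1\<close> and \<open>j\<close> give the same partition.
  Its classes are the layers: the class of the top vertex of an edge determines the classes of
  the other vertices, and a cycle of \<open>l \<le> j\<close> classes would repeat a root colour at depth \<open>l\<close>.

  The limit exists because the codegree condition passes, up to a small error, to the
  subgraph induced by a random set of vertices of a fixed large size.
\<close>

subsection \<open>Domination in truncated tree labels\<close>

text \<open>A shortest closed walk has no repeated vertex before it closes, so its length is at most
  \<open>card A\<close>. The bound matters because truncated labels control only walks no longer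
  than the truncation depth.\<close>

lemma acyclic_short_cycles:
  fixes R :: "('a \<times> 'a) set"
  assumes "finite A" "R \<subseteq> A \<times> A" "\<And>l x. 0 < l \<Longrightarrow> l \<le> card A \<Longrightarrow> (x, x) \<notin> R ^^ l"
  shows "acyclic R"
proof (rule ccontr)
  assume "\<not> acyclic R"
  then obtain x0 where "(x0, x0) \<in> R\<^sup>+" by (auto simp: acyclic_def)
  then obtain l0 where "l0 > 0 \<and> (\<exists>x. (x, x) \<in> R ^^ l0)" by (auto simp: trancl_power)
  define l where "l = (LEAST l. l > 0 \<and> (\<exists>x. (x, x) \<in> R ^^ l))"
  have l: "l > 0 \<and> (\<exists>x. (x, x) \<in> R ^^ l)"
    unfolding l_def by (rule LeastI) fact
  then obtain x where x: "(x, x) \<in> R ^^ l" by blast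
  then obtain f where f: "f 0 = x" "f l = x" "\<And>i. i < l \<Longrightarrow> (f i, f (Suc i)) \<in> R"
    by (auto simp: relpow_fun_conv)
  have "l > card A" using assms(3) l by (meson not_le)
  have "f ` {..<l} \<subseteq> A" using f(3) assms(2) by blast
  then have "card (f ` {..<l}) < card {..<l}"
    using card_mono[OF assms(1)] \<open>l > card A\<close> by (metis card_lessThan le_less_trans)
  then have "\<not> inj_on f {..<l}" using pigeonhole by blast
  then obtain a b where ab: "a < b" "b < l" "f a = f b"
    unfolding inj_on_def by (metis lessThan_iff linorder_neqE_nat)
  have "(f a, f b) \<in> R ^^ (b - a)"
    unfolding relpow_fun_conv
    using ab f(3) by (intro exI[of _ "\<lambda>i. f (a + i)"]) auto
  then have "l \<le> b - a"
    using ab unfolding l_def by (intro Least_le) auto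
  with ab show False by linarith
qed

text \<open>Counting predecessors gives monotonicity, and an arbitrary enumeration breaks ties.
  Injectivity is wanted because equal layer numbers must force equal classes in condition
  (A2).\<close>

lemma finite_acyclic_numbering:
  assumes "finite A" "R \<subseteq> A \<times> A" "acyclic R"
  obtains g :: "'a \<Rightarrow> nat" where "inj_on g A" "\<And>x y. (x, y) \<in> R \<Longrightarrow> g x < g y"
proof -
  obtain h where h: "bij_betw h A {0..<card A}"
    using ex_bij_betw_finite_nat[OF assms(1)] by blast
  have hlt: "h x < card A" if "x \<in> A" for x
    using h that by (auto simp: bij_betw_def)
  define c where "c x = card {y. (y, x) \<in> R\<^sup>+}" for x
  \<comment> \<open>A number in base \<open>card A\<close> with the predecessor count above the last
    digit \<open>h x\<close>.\<close>
  define g where "g x = c x * card A + h x" for x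
  have mod: "g x mod card A = h x" if "x \<in> A" for x
    using hlt[OF that] by (simp add: g_def)
  have RA: "R\<^sup>+ \<subseteq> A \<times> A" using assms(2) trancl_subset_Sigma by blast
  have fin: "finite {y. (y, x) \<in> R\<^sup>+}" for x
    using RA assms(1) by (auto intro: finite_subset)
  have "inj_on g A"
  proof (rule inj_onI)
    fix x y assume xy: "x \<in> A" "y \<in> A" "g x = g y"
    then have "h x = h y" using mod by metis
    with xy show "x = y" using h by (auto simp: bij_betw_def inj_on_def)
  qed
  moreover have "g x < g y" if "(x, y) \<in> R" for x y
  proof -
    \<comment> \<open>The inclusion is strict because \<open>x\<close> precedes \<open>y\<close>
      but, by acyclicity, not itself.\<close>
    have "{z. (z, x) \<in> R\<^sup>+} \<subset> {z. (z, y) \<in> R\<^sup>+}"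
      using that assms(3) by (auto simp: acyclic_def intro: trancl_into_trancl)
    then have "Suc (c x) \<le> c y" unfolding c_def using psubset_card_mono[OF fin] by (simp add: Suc_leI)
    then have "Suc (c x) * card A \<le> c y * card A" by (rule mult_le_mono1)
    moreover have "h x < card A" using that assms(2) hlt by auto
    ultimately show ?thesis by (simp add: g_def)
  qed
  ultimately show thesis using that by blast
qed

text \<open>These are the nodes of the complete \<open>r\<close>-ary tree of depth \<open>j\<close>,
  each given by its path from the root \<open>[]\<close>.\<close>

definition addresses :: "nat \<Rightarrow> nat \<Rightarrow> nat list set" where
  "addresses r j = {p. set p \<subseteq> {..<r} \<and> length p \<le> j}"

text \<open>The child \<open>i # p\<close> of an address hangs at the top: \<open>\<lambda>p. \<tau> v (i # p)\<close> is the \<open>i\<close>-th subtree.\<close>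

definition tops :: "nat \<Rightarrow> nat \<Rightarrow> ('a \<Rightarrow> nat list \<Rightarrow> 'b) \<Rightarrow> 'a \<Rightarrow> 'a list \<Rightarrow> bool" where
  "tops r m \<tau> v us \<longleftrightarrow> distinct (v # us) \<and> length us = r \<and>
     (\<forall>i<r. \<forall>p. i # p \<in> addresses r m \<longrightarrow> \<tau> v (i # p) = \<tau> (us ! i) p) \<and>
     (\<forall>p\<in>addresses r m. p \<noteq> [] \<longrightarrow> \<tau> v p \<noteq> \<tau> v [])"

lemma addresses_mono: "i \<le> j \<Longrightarrow> addresses r i \<subseteq> addresses r j"
  by (auto simp: addresses_def)

text \<open>No host appears here: \<open>\<tau>\<close> stands for the host labels pulled back along
  an embedding of \<open>F\<close>. Depth \<open>card (verts F)\<close> suffices since there are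
  never more classes than vertices, so the chosen depth \<open>j\<close> does not exceed it.\<close>

lemma layered_if_tops:
  fixes F :: "'a hypergraph" and \<tau> :: "'a \<Rightarrow> nat list \<Rightarrow> 'b"
  assumes fin: "finite (verts F)" and sub: "\<And>e. e \<in> edges F \<Longrightarrow> e \<subseteq> verts F"
    and ex: "\<And>e. e \<in> edges F \<Longrightarrow> \<exists>v us. e = set (v # us) \<and> tops r (card (verts F)) \<tau> v us"
  shows "layered F"
proof (cases "edges F = {}")
  case True
  then show ?thesis by (auto simp: layered_def layered_function_def)
next
  case False
  define m where "m = card (verts F)"
  define V where "V = verts F"
  have finV: "finite V" using fin by (simp add: V_def)
  from ex have "\<exists>a. e = set (fst a # snd a) \<and> tops r m \<tau> (fst a) (snd a)" if "e \<in> edges F" for e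
    using that unfolding m_def by simp
  then obtain a where a: "\<And>e. e \<in> edges F \<Longrightarrow> e = set (fst (a e) # snd (a e)) \<and> tops r m \<tau> (fst (a e)) (snd (a e))"
    by metis
  define t where "t e = fst (a e)" for e
  define us where "us e = snd (a e)" for e
  have e_eq: "e = set (t e # us e)" and tops: "tops r m \<tau> (t e) (us e)" if "e \<in> edges F" for e
    using a that by (auto simp: t_def us_def)
  have inV: "t e \<in> V" "set (us e) \<subseteq> V" if "e \<in> edges F" for e
    using e_eq[OF that] sub[OF that] unfolding V_def by auto
  have len: "length (us e) = r" if "e \<in> edges F" for e
    using tops[OF that] by (simp add: tops_def)
  have child: "\<tau> (t e) (i # p) = \<tau> (us e ! i) p" if "e \<in> edges F" "i # p \<in> addresses r m" for e i p
    using tops[OF that(1)] that(2) by (simp add: tops_def addresses_def)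
  have root: "\<tau> (t e) p \<noteq> \<tau> (t e) []" if "e \<in> edges F" "p \<in> addresses r m" "p \<noteq> []" for e p
    using tops[OF that(1)] that(2,3) by (simp add: tops_def)
  have "V \<noteq> {}" using False inV by blast
  define tr where "tr j v = restrict (\<tau> v) (addresses r j)" for j v
  \<comment> \<open>Minimality gives more than \<open>j - 1\<close> classes at depth
    \<open>j - 1\<close> and at most \<open>j\<close> at depth \<open>j\<close>; both counts are
    therefore \<open>j\<close>.\<close>
  define j where "j = (LEAST j. card (tr j ` V) \<le> j)"
  have jm0: "card (tr m ` V) \<le> m" unfolding m_def V_def by (rule card_image_le[OF fin])
  have j1: "card (tr j ` V) \<le> j" unfolding j_def by (rule LeastI) (rule jm0)
  have jm: "j \<le> m" unfolding j_def by (rule Least_le) (rule jm0)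
  have "j \<noteq> 0"
    using j1 \<open>V \<noteq> {}\<close> finV by (metis card_0_eq finite_imageI image_is_empty le_zero_eq)
  then obtain j' where j': "j = Suc j'" by (cases j) auto
  have j2: "card (tr j' ` V) > j'"
    using not_less_Least[of j' "\<lambda>j. card (tr j ` V) \<le> j"] j' unfolding j_def by simp
  have tr_tr: "tr j' v = restrict (tr j v) (addresses r j')" for v
    unfolding tr_def j' using addresses_mono[of j' "Suc j'" r] by (auto simp: fun_eq_iff restrict_def)
  have img: "tr j' ` V = (\<lambda>x. restrict x (addresses r j')) ` (tr j ` V)"
    by (auto simp: image_image tr_tr)
  \<comment> \<open>Forgetting the last level maps at most \<open>j\<close> classes onto at least
    \<open>j\<close> classes.\<close>
  have "inj_on (\<lambda>x. restrict x (addresses r j')) (tr j ` V)"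
    using j1 j2 img j' finV
    by (intro eq_card_imp_inj_on) (auto intro!: antisym card_image_le)
  then have stable: "tr j u = tr j v" if "tr j' u = tr j' v" "u \<in> V" "v \<in> V" for u v
    using that by (auto simp: inj_on_def tr_tr)
  \<comment> \<open>Arrows run between classes, from that of a lower vertex of an edge to that of
    its top.\<close>
  define R where "R = {(tr j u, tr j (t e)) | u e. e \<in> edges F \<and> u \<in> set (us e)}"
  have R: "R \<subseteq> tr j ` V \<times> tr j ` V" using inV unfolding R_def by blast
  \<comment> \<open>Walking \<open>l\<close> arrows back from \<open>y\<close> spells out an address
    \<open>p\<close> at which a copy of \<open>x\<close> hangs in \<open>y\<close>. Each arrow costs
    one level, so the copy is known only to depth \<open>j - l\<close>.\<close>
  have chain: "\<exists>p. set p \<subseteq> {..<r} \<and> length p = l \<and> (\<forall>p'\<in>addresses r (j - l). y (p @ p') = x p')"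
    if "(x, y) \<in> R ^^ l" "l \<le> j" for x y l
    using that
  proof (induction l arbitrary: y)
    case 0
    then show ?case by auto
  next
    case (Suc l)
    then obtain z where z: "(x, z) \<in> R ^^ l" "(z, y) \<in> R" by auto
    from Suc.IH[OF z(1)] Suc.prems obtain p where p: "set p \<subseteq> {..<r}" "length p = l"
      "\<And>p'. p'\<in>addresses r (j - l) \<Longrightarrow> z (p @ p') = x p'" by auto
    from z(2) obtain u e where ue: "z = tr j u" "y = tr j (t e)" "e \<in> edges F" "u \<in> set (us e)"
      by (auto simp: R_def)
    then obtain i where i: "i < r" "u = us e ! i" using len by (metis in_set_conv_nth)
    show ?case
    proof (intro exI[of _ "i # p"] conjI ballI)
      fix p' assume p': "p' \<in> addresses r (j - Suc l)"
      then have ad: "i # p @ p' \<in> addresses r j" "p @ p' \<in> addresses r j" "p' \<in> addresses r (j - l)"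
        using p i Suc.prems by (auto simp: addresses_def)
      have "i # p @ p' \<in> addresses r m" using ad(1) addresses_mono[OF jm] by blast
      then have "y (i # p @ p') = z (p @ p')"
        using ad child[OF ue(3)] i by (simp add: ue tr_def)
      then show "y ((i # p) @ p') = x p'" using p(3)[OF ad(3)] by simp
    qed (use p i in auto)
  qed
  \<comment> \<open>There are at most \<open>j\<close> classes, so the cycles to exclude have
    lengths within the range of \<open>chain\<close>.\<close>
  have "acyclic R"
  proof (rule acyclic_short_cycles[OF _ R])
    fix l x assume l: "0 < l" "l \<le> card (tr j ` V)"
    show "(x, x) \<notin> R ^^ l"
    proof
      assume asm: "(x, x) \<in> R ^^ l"
      with chain[of x x l] l j1 obtain p where p: "set p \<subseteq> {..<r}" "length p = l"
        "\<And>p'. p'\<in>addresses r (j - l) \<Longrightarrow> x (p @ p') = x p'" by auto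
      \<comment> \<open>The root colour of \<open>x\<close> recurs at \<open>p\<close>. As
        \<open>x\<close> also ends an arrow, it is the class of a top vertex, whose root colour must
        not recur.\<close>
      have "x p = x []" using p(3)[of "[]"] by (simp add: addresses_def)
      moreover have "p \<in> addresses r j" "p \<noteq> []" using p l j1 by (auto simp: addresses_def)
      moreover from asm l obtain z where "(z, x) \<in> R" by (cases l) auto
      then obtain e where "e \<in> edges F" "x = tr j (t e)" by (auto simp: R_def)
      ultimately show False
        using root[of e p] addresses_mono[OF jm, of r] by (auto simp: tr_def addresses_def)
    qed
  qed (use finV in auto)
  then obtain g where g: "inj_on g (tr j ` V)" "\<And>x y. (x, y) \<in> R \<Longrightarrow> g x < (g y :: nat)"
    using finite_acyclic_numbering R finV by (metis finite_imageI)
  define f where "f v = g (tr j v)" for v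
  have less: "f u < f (t e)" if "e \<in> edges F" "u \<in> set (us e)" for e u
    unfolding f_def using that by (intro g(2)) (auto simp: R_def)
  have labels: "labels f e = add_mset (f (t e)) (mset (map f (us e)))" if "e \<in> edges F" for e
  proof -
    have "distinct (t e # us e)" using tops[OF that] by (simp add: tops_def)
    then have "mset_set e = mset (t e # us e)" using e_eq[OF that] by (metis mset_set_set)
    then show ?thesis by (simp add: labels_def)
  qed
  have Max: "Max_mset (labels f e) = f (t e)" if "e \<in> edges F" for e
    using less[OF that] by (intro Max_eqI) (auto simp: labels[OF that] less_imp_le)
  show ?thesis unfolding layered_def layered_function_def
  proof (intro exI[of _ f] conjI ballI impI)
    fix e assume e: "e \<in> edges F"
    have "v = t e" if "v \<in> e" "f v = f (t e)" for v
    proof -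
      have "v \<notin> set (us e)" using less[OF e, of v] that(2) by auto
      then show ?thesis using e_eq[OF e] that(1) by (metis set_ConsD)
    qed
    moreover have "t e \<in> e" using e_eq[OF e] by (metis list.set_intros(1))
    ultimately show "\<exists>!v. v \<in> e \<and> f v = Max_mset (labels f e)"
      unfolding Max[OF e] by blast
  next
    fix e e' assume e: "e \<in> edges F" "e' \<in> edges F" and "Max_mset (labels f e) = Max_mset (labels f e')"
    then have ff: "f (t e) = f (t e')" by (simp add: Max)
    then have teq: "tr j (t e) = tr j (t e')"
      using g(1) inV e by (auto simp: f_def inj_on_def)
    \<comment> \<open>Labels of tops that agree to depth \<open>j\<close> have subtrees that agree
      only to depth \<open>j'\<close>; \<open>stable\<close> restores the lost level.\<close>
    have "f (us e ! i) = f (us e' ! i)" if i: "i < r" for i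
    proof -
      have "\<tau> (us e ! i) p = \<tau> (us e' ! i) p" if p: "p \<in> addresses r j'" for p
      proof -
        have ip: "i # p \<in> addresses r j" using p i by (auto simp: addresses_def j')
        then have "\<tau> (t e) (i # p) = \<tau> (t e') (i # p)"
          using teq by (metis restrict_apply' tr_def)
        then show ?thesis using child e ip addresses_mono[OF jm] by (metis subsetD)
      qed
      then have "tr j' (us e ! i) = tr j' (us e' ! i)" by (auto simp: tr_def restrict_def)
      moreover have "us e ! i \<in> V" "us e' ! i \<in> V" using i len inV e by (metis nth_mem subsetD)+
      ultimately show ?thesis using stable[of "us e ! i" "us e' ! i"] by (simp add: f_def)
    qed
    then have "map f (us e) = map f (us e')"
      using len e by (intro nth_equalityI) auto
    then show "labels f e = labels f e'" using ff by (simp add: labels e)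
  qed
qed

subsection \<open>Codegrees and a Chernoff bound by counting\<close>

text \<open>An edge containing \<open>S\<close> has exactly one further vertex. Codegrees thus
  become sizes of vertex sets, which sampling can estimate.\<close>

lemma hg_degree_eq_card:
  assumes "k_graph k H" "S \<subseteq> verts H" "card S = k - 1" "k > 0"
  shows "hg_degree H S = card {v \<in> verts H - S. insert v S \<in> edges H}"
proof -
  have "finite S" using assms by (auto simp: k_graph_def intro: finite_subset)
  have "bij_betw (\<lambda>v. insert v S) {v \<in> verts H - S. insert v S \<in> edges H} {e \<in> edges H. S \<subseteq> e}"
  proof (rule bij_betw_imageI)
    show "inj_on (\<lambda>v. insert v S) {v \<in> verts H - S. insert v S \<in> edges H}"
      by (auto simp: inj_on_def)
    show "(\<lambda>v. insert v S) ` {v \<in> verts H - S. insert v S \<in> edges H} = {e \<in> edges H. S \<subseteq> e}"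
    proof (intro equalityI subsetI)
      fix e assume e: "e \<in> {e \<in> edges H. S \<subseteq> e}"
      then have "card (e - S) = 1" "e \<subseteq> verts H"
        using assms \<open>finite S\<close> by (auto simp: k_graph_def card_Diff_subset)
      then obtain v where "e - S = {v}" by (auto simp: card_1_singleton_iff)
      then have "e = insert v S" "v \<in> e" "v \<notin> S" using e by auto
      then show "e \<in> (\<lambda>v. insert v S) ` {v \<in> verts H - S. insert v S \<in> edges H}"
        using e \<open>e \<subseteq> verts H\<close> by auto
    qed auto
  qed
  then show ?thesis unfolding hg_degree_def by (rule bij_betw_same_card[symmetric])
qed

section \<open>Minimum codegrees and extremal hosts\<close>

lemma finite_codegrees:
  assumes "finite (verts H)"
  shows "finite {hg_degree H S | S. S \<subseteq> verts H \<and> card S = k - 1}"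
proof (rule finite_subset)
  show "{hg_degree H S | S. S \<subseteq> verts H \<and> card S = k - 1} \<subseteq> hg_degree H ` Pow (verts H)" by blast
qed (simp add: assms)

lemma min_codegree_le_hg_degree:
  assumes "finite (verts H)" "S \<subseteq> verts H" "card S = k - 1"
  shows "min_codegree k H \<le> hg_degree H S"
  unfolding min_codegree_def
  by (intro Min_le finite_codegrees CollectI exI[of _ S] conjI refl assms)

lemma min_codegree_attained:
  assumes "finite (verts H)" "k - 1 \<le> card (verts H)"
  obtains S where "S \<subseteq> verts H" "card S = k - 1" "min_codegree k H = hg_degree H S"
proof -
  obtain S where "S \<subseteq> verts H" "card S = k - 1"
    using assms(2) by (meson obtain_subset_with_card_n)
  then have "{hg_degree H S | S. S \<subseteq> verts H \<and> card S = k - 1} \<noteq> {}" by blast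
  then have "min_codegree k H \<in> {hg_degree H S | S. S \<subseteq> verts H \<and> card S = k - 1}"
    unfolding min_codegree_def using assms by (intro Min_in finite_codegrees)
  then show thesis using that by blast
qed

lemma min_codegree_le_card:
  assumes "k_graph k H" "k > 0" "k - 1 \<le> card (verts H)"
  shows "min_codegree k H \<le> card (verts H)"
proof -
  have fin: "finite (verts H)" using assms by (simp add: k_graph_def)
  obtain S where S: "S \<subseteq> verts H" "card S = k - 1" "min_codegree k H = hg_degree H S"
    using fin assms(3) by (rule min_codegree_attained)
  note S(3)
  also have "\<dots> \<le> card (verts H)"
    unfolding hg_degree_eq_card[OF assms(1) S(1,2) assms(2)] using fin by (intro card_mono) auto
  finally show ?thesis .
qed

lemma finite_free_codegrees:
  assumes "k > 0" "k - 1 \<le> n"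
  shows "finite {min_codegree k H | H :: nat hypergraph.
            k_graph k H \<and> card (verts H) = n \<and> free_of F H}"
proof (rule finite_subset)
  show "{min_codegree k H | H :: nat hypergraph.
            k_graph k H \<and> card (verts H) = n \<and> free_of F H} \<subseteq> {..n}"
    using min_codegree_le_card assms by blast
qed simp

lemma min_codegree_le_ex_co:
  fixes H :: "nat hypergraph"
  assumes "k > 0" "k - 1 \<le> card (verts H)" "k_graph k H" "free_of F H"
  shows "min_codegree k H \<le> ex_co k (card (verts H)) F"
  unfolding ex_co_def
  by (intro Max_ge finite_free_codegrees CollectI exI[of _ H] conjI refl assms)

lemma ex_co_attained:
  assumes "k > 0" "k - 1 \<le> n" "edges F \<noteq> {}"
  obtains H :: "nat hypergraph"
  where "k_graph k H" "card (verts H) = n" "free_of F H" "min_codegree k H = ex_co k n F"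
proof -
  \<comment> \<open>The edgeless host contains no copy of \<open>F\<close>, since \<open>F\<close>
    has an edge; hence the maximum ranges over a nonempty set.\<close>
  define E :: "nat hypergraph" where "E = ({..<n}, {})"
  have "k_graph k E \<and> card (verts E) = n \<and> free_of F E"
    using assms(3) by (auto simp: E_def k_graph_def verts_def edges_def free_of_def subhypergraph_def hg_iso_def)
  then have "{min_codegree k H | H :: nat hypergraph.
            k_graph k H \<and> card (verts H) = n \<and> free_of F H} \<noteq> {}" by blast
  then have "ex_co k n F \<in> {min_codegree k H | H :: nat hypergraph.
            k_graph k H \<and> card (verts H) = n \<and> free_of F H}"
    unfolding ex_co_def by (intro Max_in finite_free_codegrees assms)
  then obtain H :: "nat hypergraph" where
    "ex_co k n F = min_codegree k H" "k_graph k H" "card (verts H) = n" "free_of F H" by blast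
  then show thesis by (intro that[of H]) simp_all
qed

lemma ex_co_le:
  assumes "k > 0" "k - 1 \<le> n" "edges F \<noteq> {}"
  shows "ex_co k n F \<le> n"
proof -
  from assms obtain H :: "nat hypergraph" where
    "k_graph k H" "card (verts H) = n" "min_codegree k H = ex_co k n F" by (rule ex_co_attained)
  then show ?thesis using min_codegree_le_card[of k H] assms by simp
qed

section \<open>Exponential moments and the lower tail of independent samples\<close>

lemma exp_minus_le_quadratic:
  fixes x :: real
  assumes "0 \<le> x"
  shows "exp (- x) \<le> 1 - x + x\<^sup>2 / 2"
proof -
  \<comment> \<open>The cubic Lagrange remainder is nonpositive, as
    \<open>- x \<le> 0\<close>.\<close>
  obtain t where "exp (- x) = (\<Sum>m<3. (- x) ^ m / fact m) + exp t / fact 3 * (- x) ^ 3"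
    using Maclaurin_exp_le[of "- x" 3] by blast
  moreover have "(\<Sum>m<3. (- x) ^ m / fact m) = 1 - x + x\<^sup>2 / 2"
    by (simp add: numeral_3_eq_3 power2_eq_square)
  ultimately show ?thesis using assms by (simp add: power_minus_odd)
qed

text \<open>Markov's inequality for a product of exponential weights, stated as a count of
  functions. Coordinates outside \<open>J\<close> may range over any finite sets, in particular over
  singletons, so that part of a sample can be held fixed.\<close>

lemma chernoff_PiE:
  fixes B :: "'i \<Rightarrow> 'a set" and p \<epsilon> :: real
  assumes "finite K" "J \<subseteq> K" "\<And>i. i \<in> K \<Longrightarrow> finite (B i)" "\<And>i. i \<in> J \<Longrightarrow> B i = V"
    and "finite V" "D \<subseteq> V" "p * card V \<le> card D" "p \<le> 1" "0 \<le> \<epsilon>"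
  shows "card {x \<in> PiE K B. real (card {j\<in>J. x j \<in> D}) \<le> (p - \<epsilon>) * card J}
      \<le> (\<Prod>i\<in>K. card (B i)) * exp (- \<epsilon>\<^sup>2 * card J / 2)"
proof -
  \<comment> \<open>exponential moment with parameter \<open>\<epsilon>\<close>\<close>
  define g where "g i w = (if i \<in> J then exp (\<epsilon> * (p - \<epsilon> - of_bool (w \<in> D))) else 1)" for i w
  have finJ: "finite J" using assms(1,2) finite_subset by blast
  have finP: "finite (PiE K B)" using assms by (intro finite_PiE) auto
  have gprod: "(\<Prod>i\<in>K. g i (x i)) = exp (\<epsilon> * ((p - \<epsilon>) * card J - card {j\<in>J. x j \<in> D}))" for x
  proof -
    have "(\<Prod>i\<in>K. g i (x i)) = (\<Prod>i\<in>J. exp (\<epsilon> * (p - \<epsilon> - of_bool (x i \<in> D))))"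
      unfolding g_def using assms(1,2) by (subst prod.inter_restrict[symmetric]) (auto simp: Int_absorb1)
    also have "\<dots> = exp (\<Sum>i\<in>J. \<epsilon> * (p - \<epsilon> - of_bool (x i \<in> D)))"
      using finJ by (simp add: exp_sum)
    also have "(\<Sum>i\<in>J. \<epsilon> * (p - \<epsilon> - of_bool (x i \<in> D))) = \<epsilon> * ((p - \<epsilon>) * card J - card {j\<in>J. x j \<in> D})"
    proof -
      have "(\<Sum>i\<in>J. of_bool (x i \<in> D)) = real (card {j\<in>J. x j \<in> D})"
        using finJ by (simp add: sum_of_bool_eq Int_def)
      then show ?thesis
        by (simp only: sum_distrib_left[symmetric] sum_subtractf sum_constant) (simp add: algebra_simps)
    qed
    finally show ?thesis .
  qed
  have gsum: "(\<Sum>w\<in>B i. g i w) \<le> card (B i) * (if i \<in> J then exp (- \<epsilon>\<^sup>2 / 2) else 1)" if i: "i \<in> K" for i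
  proof (cases "i \<in> J")
    case True
    have "(\<Sum>w\<in>B i. g i w) = exp (\<epsilon> * (p - \<epsilon>)) * (\<Sum>w\<in>V. exp (- \<epsilon> * of_bool (w \<in> D)))"
      using True assms(4) by (simp add: g_def sum_distrib_left exp_add[symmetric] algebra_simps)
    also have "(\<Sum>w\<in>V. exp (- \<epsilon> * of_bool (w \<in> D))) = (\<Sum>w\<in>V. 1 - (1 - exp (-\<epsilon>)) * of_bool (w \<in> D))"
      by (intro sum.cong) auto
    also have "\<dots> = card V - (1 - exp (-\<epsilon>)) * card D"
    proof -
      have "(\<Sum>w\<in>V. of_bool (w \<in> D)) = real (card D)"
        using assms(5,6) by (simp add: sum_of_bool_eq Int_absorb1)
      then show ?thesis
        by (simp only: sum_distrib_left[symmetric] sum_subtractf sum_constant mult_1_right)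
    qed
    also have "exp (\<epsilon> * (p - \<epsilon>)) * \<dots> \<le> exp (\<epsilon> * (p - \<epsilon>)) * (card V * exp (- p * (1 - exp (-\<epsilon>))))"
    proof (intro mult_left_mono)
      have "card V - (1 - exp (-\<epsilon>)) * card D \<le> card V - (1 - exp (-\<epsilon>)) * (p * card V)"
        using assms(7,9) by (intro diff_left_mono mult_left_mono) auto
      also have "\<dots> = card V * (1 + (- p * (1 - exp (-\<epsilon>))))" by (simp add: algebra_simps)
      also have "\<dots> \<le> card V * exp (- p * (1 - exp (-\<epsilon>)))"
        by (intro mult_left_mono exp_ge_add_one_self) auto
      finally show "card V - (1 - exp (-\<epsilon>)) * card D \<le> card V * exp (- p * (1 - exp (-\<epsilon>)))" .
    qed auto
    also have "\<dots> = card V * exp (- \<epsilon>\<^sup>2 + p * (exp (-\<epsilon>) - 1 + \<epsilon>))"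
      by (simp add: exp_add[symmetric] algebra_simps power2_eq_square)
    \<comment> \<open>Since \<open>p \<le> 1\<close>, the second order error is at most
      \<open>\<epsilon>\<^sup>2 / 2\<close>, half of the main term.\<close>
    also have "\<dots> \<le> card V * exp (- \<epsilon>\<^sup>2 / 2)"
    proof -
      have "0 \<le> exp (-\<epsilon>) - 1 + \<epsilon>" using exp_ge_add_one_self[of "-\<epsilon>"] by simp
      moreover have "exp (-\<epsilon>) - 1 + \<epsilon> \<le> \<epsilon>\<^sup>2 / 2"
        using exp_minus_le_quadratic[OF assms(9)] by simp
      ultimately have "p * (exp (-\<epsilon>) - 1 + \<epsilon>) \<le> \<epsilon>\<^sup>2 / 2"
        using mult_right_mono[OF assms(8), of "exp (-\<epsilon>) - 1 + \<epsilon>"] by simp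
      then show ?thesis by (intro mult_left_mono) auto
    qed
    finally show ?thesis using True assms(4) by simp
  qed (auto simp: g_def)
  have "real (card {x \<in> PiE K B. real (card {j\<in>J. x j \<in> D}) \<le> (p - \<epsilon>) * card J})
      = (\<Sum>x | x \<in> PiE K B \<and> real (card {j\<in>J. x j \<in> D}) \<le> (p - \<epsilon>) * card J. 1)" by simp
  \<comment> \<open>Markov's step: each counted function has weight at least 1.\<close>
  also have "\<dots> \<le> (\<Sum>x | x \<in> PiE K B \<and> real (card {j\<in>J. x j \<in> D}) \<le> (p - \<epsilon>) * card J. \<Prod>i\<in>K. g i (x i))"
    using assms(9) by (intro sum_mono) (auto simp: gprod)
  also have "\<dots> \<le> (\<Sum>x\<in>PiE K B. \<Prod>i\<in>K. g i (x i))"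
    by (intro sum_mono2[OF finP]) (auto simp: gprod)
  also have "\<dots> = (\<Prod>i\<in>K. \<Sum>w\<in>B i. g i w)"
    using assms(1,3) by (intro prod_sum_PiE[symmetric]) auto
  also have "\<dots> \<le> (\<Prod>i\<in>K. card (B i) * (if i \<in> J then exp (- \<epsilon>\<^sup>2 / 2) else 1))"
    using gsum by (intro prod_mono) (auto simp: g_def intro!: sum_nonneg)
  also have "\<dots> = (\<Prod>i\<in>K. card (B i)) * exp (- \<epsilon>\<^sup>2 / 2) ^ card J"
    unfolding prod.distrib using assms(1,2) by (subst prod.If_cases) (simp_all add: Int_absorb1)
  also have "exp (- \<epsilon>\<^sup>2 / 2) ^ card J = exp (- \<epsilon>\<^sup>2 * card J / 2)"
    by (simp add: exp_of_nat_mult[symmetric] algebra_simps)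
  finally show ?thesis .
qed

subsection \<open>Existence of the limit\<close>

text \<open>A union bound over random \<open>n\<close>-tuples of vertices. The first term of
  \<open>small\<close> bounds the tuples with a repetition, the second those in which some
  \<open>k - 1\<close> positions have too few completing positions.\<close>

lemma ex_injective_sample:
  fixes H :: "'a hypergraph" and \<epsilon> :: real
  assumes H: "k_graph k H" and k: "k > 0" "k \<le> n"
    and N: "k - 1 \<le> card (verts H)" "card (verts H) > 0" and \<epsilon>: "0 \<le> \<epsilon>"
    and small: "real (n\<^sup>2) / card (verts H) + real n ^ (k - 1) * exp (- \<epsilon>\<^sup>2 * real (n - (k - 1)) / 2) < 1"
  obtains x where "x ` {..<n} \<subseteq> verts H" "inj_on x {..<n}"
    and "\<And>I. I \<subseteq> {..<n} \<Longrightarrow> card I = k - 1 \<Longrightarrow>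
      (real (min_codegree k H) / card (verts H) - \<epsilon>) * real (n - (k - 1))
        < card {j \<in> {..<n} - I. x j \<notin> x ` I \<and> insert (x j) (x ` I) \<in> edges H}"
proof -
  define V where "V = verts H"
  define N where "N = card V"
  define K where "K = {..<n}"
  define p where "p = real (min_codegree k H) / N"
  define r where "r = n - (k - 1)"
  define \<delta> where "\<delta> = exp (- \<epsilon>\<^sup>2 * real r / 2)"
  define D where "D S = {v \<in> V - S. insert v S \<in> edges H}" for S
  define \<Omega> where "\<Omega> = PiE K (\<lambda>_. V)"
  define bad where "bad I = {x \<in> \<Omega>. inj_on x I \<and> real (card {j \<in> K - I. x j \<in> D (x ` I)}) \<le> (p - \<epsilon>) * r}" for I
  define coll where "coll = (\<lambda>(i, j). {x \<in> \<Omega>. x i = x j})"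
  define Is where "Is = {I. I \<subseteq> K \<and> card I = k - 1}"
  define ijs where "ijs = {(i, j). i \<in> K \<and> j \<in> K \<and> i \<noteq> j}"
  have finV: "finite V" using H by (simp add: k_graph_def V_def)
  have finK: "finite K" "card K = n" by (auto simp: K_def)
  have N0: "N > 0" using assms by (simp add: N_def V_def)
  have \<Omega>: "finite \<Omega>" "card \<Omega> = N ^ n"
    unfolding \<Omega>_def by (auto intro!: finite_PiE simp: finK finV card_PiE N_def)
  have p1: "p \<le> 1"
    using min_codegree_le_card[OF H k(1) N(1)] N0 by (simp add: p_def N_def V_def)
  have coll: "real (card (coll ij)) \<le> N ^ n / N" if "ij \<in> ijs" for ij
  proof -
    obtain i j where ij: "ij = (i, j)" "i \<in> K" "j \<in> K" "i \<noteq> j" using \<open>ij \<in> ijs\<close> by (auto simp: ijs_def)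
    define B where "B w l = (if l \<in> {i, j} then {w} else V)" for w l
    \<comment> \<open>Sorting by the common value \<open>w\<close> gives \<open>N\<close> families,
      each with \<open>n - 2\<close> free coordinates.\<close>
    have "coll ij \<subseteq> (\<Union>w\<in>V. PiE K (B w))"
    proof
      fix x assume x: "x \<in> coll ij"
      then have "x \<in> PiE K (B (x i))" "x i \<in> V"
        using ij by (auto simp: coll_def \<Omega>_def B_def PiE_iff)
      then show "x \<in> (\<Union>w\<in>V. PiE K (B w))" by blast
    qed
    then have "card (coll ij) \<le> card (\<Union>w\<in>V. PiE K (B w))"
      by (intro card_mono) (auto intro!: finite_PiE simp: finK finV B_def)
    also have "\<dots> \<le> (\<Sum>w\<in>V. card (PiE K (B w)))" by (intro card_UN_le finV)
    also have "\<dots> = (\<Sum>w\<in>V. N ^ (n - 2))"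
    proof (intro sum.cong refl)
      fix w
      have "card (PiE K (B w)) = (\<Prod>l\<in>K. if l \<in> {i, j} then 1 else N)"
        unfolding card_PiE[OF finK(1)] by (intro prod.cong) (auto simp: B_def N_def)
      also have "\<dots> = (\<Prod>l\<in>K - {i, j}. N)"
        using finK by (intro prod.mono_neutral_cong_right) auto
      also have "\<dots> = N ^ card (K - {i, j})" by simp
      also have "card (K - {i, j}) = n - 2" using ij finK by (subst card_Diff_subset) auto
      finally show "card (PiE K (B w)) = N ^ (n - 2)" .
    qed
    also have "\<dots> = N ^ Suc (n - 2)" by (simp add: N_def)
    also have "Suc (n - 2) = n - 1"
    proof -
      have "card {i, j} \<le> card K" using ij finK by (intro card_mono) auto
      then show ?thesis using ij finK by simp
    qed
    finally have "real (card (coll ij)) \<le> real (N ^ (n - 1))" by (simp only: of_nat_le_iff)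
    also have "\<dots> = N ^ n / N" using k N0 by (cases n) auto
    finally show ?thesis by simp
  qed
  have bad: "real (card (bad I)) \<le> N ^ n * \<delta>" if "I \<in> Is" for I
  proof -
    have I: "I \<subseteq> K" "card I = k - 1" "finite I" using that finK by (auto simp: Is_def intro: finite_subset)
    \<comment> \<open>Fix the sample on \<open>I\<close>: the other coordinates are then independent.\<close>
    define Y where "Y = {y \<in> PiE I (\<lambda>_. V). inj_on y I}"
    have finY: "finite Y"
      unfolding Y_def using I finV by (intro finite_subset[OF _ finite_PiE[of I "\<lambda>_. V"]]) auto
    define B where "B y l = (if l \<in> I then {y l} else V)" for y and l :: nat
    define Z where "Z y = {x \<in> PiE K (B y). real (card {j \<in> K - I. x j \<in> D (y ` I)}) \<le> (p - \<epsilon>) * card (K - I)}" for y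
    have cKI: "card (K - I) = r" using I finK by (simp add: card_Diff_subset r_def)
    have "bad I \<subseteq> (\<Union>y\<in>Y. Z y)"
    proof
      fix x assume x: "x \<in> bad I"
      let ?y = "restrict x I"
      have "?y \<in> Y" "?y ` I = x ` I" using x I by (auto simp: Y_def bad_def \<Omega>_def inj_on_def)
      moreover have "x \<in> PiE K (B ?y)" using x I by (auto simp: bad_def \<Omega>_def B_def PiE_iff)
      ultimately show "x \<in> (\<Union>y\<in>Y. Z y)" using x by (auto simp: Z_def bad_def cKI intro!: bexI[of _ ?y])
    qed
    moreover have "finite (Z y)" for y
      unfolding Z_def using finK finV by (intro finite_subset[OF _ finite_PiE[of K "B y"]]) (auto simp: B_def)
    ultimately have "card (bad I) \<le> card (\<Union>y\<in>Y. Z y)" using finY by (intro card_mono) auto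
    also have "\<dots> \<le> (\<Sum>y\<in>Y. card (Z y))" by (intro card_UN_le finY)
    finally have "real (card (bad I)) \<le> (\<Sum>y\<in>Y. real (card (Z y)))" by (simp flip: of_nat_sum)
    also have "\<dots> \<le> (\<Sum>y\<in>Y. N ^ r * \<delta>)"
    proof (intro sum_mono)
      fix y assume y: "y \<in> Y"
      have S: "y ` I \<subseteq> verts H" "card (y ` I) = k - 1"
        using y I by (auto simp: Y_def V_def card_image)
      have "min_codegree k H \<le> card (D (y ` I))"
        using min_codegree_le_hg_degree[OF _ S] hg_degree_eq_card[OF H S k(1)] finV
        by (simp add: D_def V_def)
      then have "p * card V \<le> card (D (y ` I))" using N0 by (simp add: p_def N_def)
      then have "card (Z y) \<le> (\<Prod>l\<in>K. card (B y l)) * exp (- \<epsilon>\<^sup>2 * card (K - I) / 2)"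
        unfolding Z_def using finK finV p1 \<epsilon>
        by (intro chernoff_PiE[where V = V]) (auto simp: B_def D_def)
      also have "(\<Prod>l\<in>K. card (B y l)) = (\<Prod>l\<in>K. if l \<in> I then 1 else N)"
        by (intro prod.cong) (auto simp: B_def N_def)
      also have "\<dots> = (\<Prod>l\<in>K - I. N)"
        using finK by (intro prod.mono_neutral_cong_right) auto
      also have "\<dots> = N ^ card (K - I)" by simp
      finally show "card (Z y) \<le> N ^ r * \<delta>" by (simp add: cKI \<delta>_def)
    qed
    also have "\<dots> = card Y * (N ^ r * \<delta>)" by simp
    also have "\<dots> \<le> N ^ (k - 1) * (N ^ r * \<delta>)"
    proof -
      have "card Y \<le> card (PiE I (\<lambda>_. V))"
        unfolding Y_def using I finV by (intro card_mono finite_PiE) auto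
      then have "card Y \<le> N ^ (k - 1)" using I by (simp add: card_PiE N_def)
      then show ?thesis by (intro mult_right_mono) (auto simp: \<delta>_def simp flip: of_nat_power)
    qed
    also have "\<dots> = N ^ n * \<delta>"
    proof -
      have "k - 1 + r = n" using k by (simp add: r_def)
      then show ?thesis by (metis (no_types, lifting) mult.assoc of_nat_mult power_add)
    qed
    finally show ?thesis .
  qed
  have fin: "finite ijs" "finite Is"
    using finK by (auto simp: Is_def ijs_def intro: finite_subset[of _ "K \<times> K"])
  have "card ijs \<le> card (K \<times> K)" using finK by (intro card_mono) (auto simp: ijs_def)
  then have cij: "card ijs \<le> n\<^sup>2" using finK by (simp add: power2_eq_square)
  have "card Is = n choose (k - 1)" unfolding Is_def using n_subsets[OF finK(1)] finK by simp
  then have cI: "card Is \<le> n ^ (k - 1)" using binomial_le_pow[of "k - 1" n] k by simp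
  let ?X = "(\<Union>ij\<in>ijs. coll ij) \<union> (\<Union>I\<in>Is. bad I)"
  have "real (card ?X) \<le> real (card (\<Union>ij\<in>ijs. coll ij)) + real (card (\<Union>I\<in>Is. bad I))"
    using card_Un_le by (metis of_nat_add of_nat_le_iff)
  also have "\<dots> \<le> real (\<Sum>ij\<in>ijs. card (coll ij)) + real (\<Sum>I\<in>Is. card (bad I))"
    using card_UN_le[OF fin(1), of coll] card_UN_le[OF fin(2), of bad] by (simp del: of_nat_sum)
  also have "\<dots> \<le> (\<Sum>ij\<in>ijs. N ^ n / N) + (\<Sum>I\<in>Is. N ^ n * \<delta>)"
    unfolding of_nat_sum by (intro add_mono sum_mono coll bad)
  also have "\<dots> = card ijs * (N ^ n / N) + card Is * (N ^ n * \<delta>)" by simp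
  also have "\<dots> \<le> real (n\<^sup>2) * (N ^ n / N) + real (n ^ (k - 1)) * (N ^ n * \<delta>)"
    using cij cI by (intro add_mono mult_right_mono) (auto simp: \<delta>_def simp flip: of_nat_power)
  also have "\<dots> = N ^ n * (real (n\<^sup>2) / N + real n ^ (k - 1) * \<delta>)" by (simp add: algebra_simps)
  also have "\<dots> < real (N ^ n) * 1"
    using small N0 unfolding N_def V_def \<delta>_def r_def by (intro mult_strict_left_mono) auto
  finally have "card ?X < card \<Omega>" by (simp add: \<Omega> flip: of_nat_power)
  moreover have "?X \<subseteq> \<Omega>" by (auto simp: coll_def bad_def)
  ultimately obtain x where x: "x \<in> \<Omega>" "x \<notin> ?X" by (metis less_irrefl subsetI subset_antisym)
  have inj: "inj_on x K"
  proof (rule inj_onI, rule ccontr)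
    fix i j assume "i \<in> K" "j \<in> K" "x i = x j" "i \<noteq> j"
    then have "(i, j) \<in> ijs" "x \<in> coll (i, j)" using x by (auto simp: coll_def ijs_def)
    then show False using x by blast
  qed
  show thesis
  proof (rule that[of x])
    show "x ` {..<n} \<subseteq> verts H" using x(1) by (auto simp: \<Omega>_def K_def V_def)
    show "inj_on x {..<n}" using inj by (simp add: K_def)
    fix I assume I: "I \<subseteq> {..<n}" "card I = k - 1"
    then have "inj_on x I" using inj by (auto simp: K_def intro: inj_on_subset)
    moreover have "x \<notin> bad I" using x I by (auto simp: Is_def K_def)
    ultimately have "(p - \<epsilon>) * r < card {j \<in> K - I. x j \<in> D (x ` I)}" using x by (simp add: bad_def)
    also have "{j \<in> K - I. x j \<in> D (x ` I)} = {j \<in> {..<n} - I. x j \<notin> x ` I \<and> insert (x j) (x ` I) \<in> edges H}"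
      using x(1) by (auto simp: D_def K_def \<Omega>_def)
    finally show "(real (min_codegree k H) / card (verts H) - \<epsilon>) * real (n - (k - 1))
        < card {j \<in> {..<n} - I. x j \<notin> x ` I \<and> insert (x j) (x ` I) \<in> edges H}"
      by (simp add: p_def r_def N_def V_def)
  qed
qed

lemma free_of_subhypergraph:
  assumes "free_of F H" "subhypergraph G H"
  shows "free_of F G"
proof -
  have "subhypergraph G' H" if "subhypergraph G' G" for G'
    using that assms(2) by (auto simp: subhypergraph_def)
  then show ?thesis using assms(1) by (auto simp: free_of_def)
qed

text \<open>The sample of an extremal host on \<open>N\<close> vertices induces an
  \<open>F\<close>-free graph on \<open>n\<close> vertices whose codegrees are nearly
  proportional.\<close>

lemma ex_co_sampling:
  fixes F :: "'a hypergraph" and \<epsilon> :: real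
  assumes k: "k > 0" "k \<le> n" and F: "edges F \<noteq> {}" and N: "n \<le> N" and \<epsilon>: "0 \<le> \<epsilon>"
    and small: "real (n\<^sup>2) / N + real n ^ (k - 1) * exp (- \<epsilon>\<^sup>2 * real (n - (k - 1)) / 2) < 1"
  shows "real (ex_co k N F) / N \<le> (ex_co k n F + real (k - 1)) / n + \<epsilon>"
proof -
  define p where "p = real (ex_co k N F) / N"
  have "k - 1 \<le> N" using k N by simp
  then obtain H :: "nat hypergraph" where H: "k_graph k H" "card (verts H) = N" "free_of F H"
      "min_codegree k H = ex_co k N F"
    using ex_co_attained[OF k(1) _ F] by metis
  have small': "real (n\<^sup>2) / card (verts H) + real n ^ (k - 1) * exp (- \<epsilon>\<^sup>2 * real (n - (k - 1)) / 2) < 1"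
    using small H by simp
  obtain x where x: "x ` {..<n} \<subseteq> verts H" "inj_on x {..<n}"
    and deg: "\<And>I. I \<subseteq> {..<n} \<Longrightarrow> card I = k - 1 \<Longrightarrow> (p - \<epsilon>) * real (n - (k - 1))
        < card {j \<in> {..<n} - I. x j \<notin> x ` I \<and> insert (x j) (x ` I) \<in> edges H}"
    by (rule ex_injective_sample[OF H(1) k _ _ \<epsilon> small']) (use H N k in \<open>auto simp: p_def\<close>)
  define W where "W = x ` {..<n}"
  define G where "G = (W, {e \<in> edges H. e \<subseteq> W})"
  have vG: "verts G = W" and eG: "edges G = {e \<in> edges H. e \<subseteq> W}"
    by (simp_all add: G_def verts_def edges_def)
  have finW: "finite W" and cW: "card W = n" using x by (simp_all add: W_def card_image)
  have G: "k_graph k G" using H(1) finW by (auto simp: k_graph_def vG eG)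
  have "subhypergraph G H" using x(1) by (auto simp: subhypergraph_def vG eG W_def)
  then have "free_of F G" using H(3) free_of_subhypergraph by blast
  then have ex: "min_codegree k G \<le> ex_co k n F"
    using min_codegree_le_ex_co[OF k(1) _ G \<open>free_of F G\<close>] k by (simp add: vG cW)
  obtain S where S: "S \<subseteq> verts G" "card S = k - 1" "min_codegree k G = hg_degree G S"
    using min_codegree_attained[of G k] finW cW k by (metis diff_le_self le_trans vG)
  \<comment> \<open>The sample bound speaks of positions, so the set \<open>S\<close> of least
    codegree is pulled back to them.\<close>
  define I where "I = {i \<in> {..<n}. x i \<in> S}"
  have xI: "x ` I = S" using S(1) by (auto simp: I_def vG W_def)
  moreover have "inj_on x I" using x(2) by (rule inj_on_subset) (auto simp: I_def)
  ultimately have "card I = k - 1" using S(2) card_image by fastforce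
  then have "(p - \<epsilon>) * real (n - (k - 1)) < card {j \<in> {..<n} - I. x j \<notin> S \<and> insert (x j) S \<in> edges H}"
    using deg[of I, unfolded xI] by (simp add: I_def subset_eq)
  also have "card {j \<in> {..<n} - I. x j \<notin> S \<and> insert (x j) S \<in> edges H} \<le> hg_degree G S"
    unfolding hg_degree_eq_card[OF G S(1,2) k(1)]
  proof (rule card_inj_on_le)
    show "inj_on x {j \<in> {..<n} - I. x j \<notin> S \<and> insert (x j) S \<in> edges H}"
      using x(2) by (rule inj_on_subset) auto
    show "x ` {j \<in> {..<n} - I. x j \<notin> S \<and> insert (x j) S \<in> edges H} \<subseteq> {v \<in> verts G - S. insert v S \<in> edges G}"
      using S(1) by (auto simp: vG eG W_def)
  qed (simp add: vG finW)
  finally have main: "(p - \<epsilon>) * real (n - (k - 1)) < ex_co k n F" using ex S(3) by simp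
  \<comment> \<open>Hence passing from \<open>n - (k - 1)\<close> positions to all \<open>n\<close>
    costs at most \<open>k - 1\<close>.\<close>
  have "p \<le> 1"
    using ex_co_le[OF k(1) \<open>k - 1 \<le> N\<close> F] by (simp add: p_def divide_le_eq)
  then have "(p - \<epsilon>) * real (k - 1) \<le> 1 * real (k - 1)" using \<epsilon> by (intro mult_right_mono) auto
  moreover have "(p - \<epsilon>) * n = (p - \<epsilon>) * real (n - (k - 1)) + (p - \<epsilon>) * real (k - 1)"
    using k by (simp flip: distrib_left of_nat_add)
  ultimately have "(p - \<epsilon>) * n \<le> ex_co k n F + real (k - 1)" using main by linarith
  then have "p - \<epsilon> \<le> (ex_co k n F + real (k - 1)) / n" using k by (simp add: pos_le_divide_eq)
  then show ?thesis by (simp add: p_def)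
qed

lemma convergent_if_almost_decreasing:
  fixes a :: "nat \<Rightarrow> real"
  assumes "\<And>n. l \<le> a n" "eventually (\<lambda>n. a n \<le> u) sequentially"
    and dec: "\<And>\<epsilon>. \<epsilon> > 0 \<Longrightarrow> eventually (\<lambda>n. eventually (\<lambda>N. a N \<le> a n + \<epsilon>) sequentially) sequentially"
  shows "convergent a"
proof -
  \<comment> \<open>The supremum of the eventual lower bounds is the limit inferior, which will be
    the limit.\<close>
  define X where "X = {x. eventually (\<lambda>n. x \<le> a n) sequentially}"
  have "l \<in> X" using assms(1) by (simp add: X_def)
  have "x \<le> u" if "x \<in> X" for x
  proof -
    from that assms(2) have "eventually (\<lambda>n. x \<le> u) sequentially"
      unfolding X_def mem_Collect_eq by eventually_elim simp
    then show ?thesis by simp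
  qed
  then have bdd: "bdd_above X" by (auto simp: bdd_above_def)
  have "a \<longlonglongrightarrow> Sup X"
  proof (rule tendstoI)
    fix \<epsilon> :: real assume "\<epsilon> > 0"
    then obtain x where x: "x \<in> X" "Sup X - \<epsilon> < x"
      using less_cSup_iff[of X "Sup X - \<epsilon>"] bdd \<open>l \<in> X\<close> by auto
    \<comment> \<open>So \<open>a\<close> drops below this value infinitely often, and
      near-monotonicity from one suitable such index keeps all later terms below
      \<open>Sup X + \<epsilon>\<close>.\<close>
    have "Sup X + \<epsilon> / 2 \<notin> X" using cSup_upper[OF _ bdd, of "Sup X + \<epsilon> / 2"] \<open>\<epsilon> > 0\<close> by auto
    then have "frequently (\<lambda>n. a n < Sup X + \<epsilon> / 2) sequentially"
      by (simp add: X_def frequently_def not_less)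
    then obtain n where n: "a n < Sup X + \<epsilon> / 2" "eventually (\<lambda>N. a N \<le> a n + \<epsilon> / 2) sequentially"
      using frequently_eventually_frequently[OF _ dec[of "\<epsilon> / 2"]] \<open>\<epsilon> > 0\<close>
      by (metis (mono_tags, lifting) frequently_ex half_gt_zero)
    from x(1) have "eventually (\<lambda>N. x \<le> a N) sequentially" by (simp add: X_def)
    with n(2) show "eventually (\<lambda>N. dist (a N) (Sup X) < \<epsilon>) sequentially"
      by eventually_elim (use n(1) x(2) in \<open>auto simp: dist_real_def abs_less_iff\<close>)
  qed
  then show ?thesis by (rule convergentI)
qed

lemma power_times_exp_tendsto_0:
  fixes c d :: real
  assumes "c > 0"
  shows "(\<lambda>n. real n ^ k * exp (d - c * real n)) \<longlonglongrightarrow> 0"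
proof -
  have "filterlim (\<lambda>n. c * real n) at_top sequentially"
    using assms by (intro filterlim_tendsto_pos_mult_at_top[OF tendsto_const]) (auto intro: filterlim_real_sequentially)
  then have "(\<lambda>n. (c * real n) ^ k / exp (c * real n)) \<longlonglongrightarrow> 0"
    using tendsto_power_div_exp_0 by (rule filterlim_compose[rotated])
  then have "(\<lambda>n. exp d / c ^ k * ((c * real n) ^ k / exp (c * real n))) \<longlonglongrightarrow> exp d / c ^ k * 0"
    by (rule tendsto_mult_left)
  then show ?thesis using assms by (simp add: power_mult_distrib exp_diff field_simps)
qed

lemma convergent_ex_co:
  fixes F :: "'a hypergraph"
  assumes k: "k > 0" and F: "edges F \<noteq> {}"
  shows "convergent (\<lambda>n. real (ex_co k n F) / n)"
proof (rule convergent_if_almost_decreasing)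
  show "eventually (\<lambda>n. real (ex_co k n F) / n \<le> 1) sequentially"
    using eventually_ge_at_top[of k]
  proof eventually_elim
    case (elim n)
    then show ?case using ex_co_le[OF k _ F, of n] by (simp add: divide_le_eq)
  qed
next
  fix \<epsilon> :: real assume \<epsilon>: "\<epsilon> > 0"
  \<comment> \<open>Half of \<open>\<epsilon>\<close> pays for the sampling deviation and half for
    the term \<open>(k - 1) / n\<close>. First \<open>n\<close> is made large for the exponential
    term, then \<open>N\<close> in terms of \<open>n\<close> for the repetitions.\<close>
  define \<eta> where "\<eta> = \<epsilon> / 2"
  have \<eta>: "\<eta> > 0" using \<epsilon> by (simp add: \<eta>_def)
  have "eventually (\<lambda>n. real n ^ (k - 1) * exp (\<eta>\<^sup>2 * real (k - 1) / 2 - \<eta>\<^sup>2 / 2 * real n) < 1 / 2) sequentially"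
    using \<eta> by (intro order_tendstoD(2)[OF power_times_exp_tendsto_0]) auto
  moreover have "(\<lambda>n. real (k - 1) / real n) \<longlonglongrightarrow> 0" by real_asymp
  then have "eventually (\<lambda>n. real (k - 1) / real n < \<eta>) sequentially"
    using \<eta> by (rule order_tendstoD(2))
  ultimately show "eventually (\<lambda>n. eventually (\<lambda>N. real (ex_co k N F) / N \<le> real (ex_co k n F) / n + \<epsilon>) sequentially) sequentially"
    using eventually_ge_at_top[of k]
  proof eventually_elim
    case n: (elim n)
    have "(\<lambda>N. real (n\<^sup>2) / real N) \<longlonglongrightarrow> 0" by real_asymp
    then have "eventually (\<lambda>N. real (n\<^sup>2) / real N < 1 / 2) sequentially"
      by (rule order_tendstoD(2)) simp
    then show ?case using eventually_ge_at_top[of n]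
    proof eventually_elim
      case N: (elim N)
      have "- \<eta>\<^sup>2 * real (n - (k - 1)) / 2 = \<eta>\<^sup>2 * real (k - 1) / 2 - \<eta>\<^sup>2 / 2 * real n"
        using n(3) by (simp add: of_nat_diff algebra_simps diff_divide_distrib)
      then have "real (n\<^sup>2) / N + real n ^ (k - 1) * exp (- \<eta>\<^sup>2 * real (n - (k - 1)) / 2) < 1"
        using n(1) N(1) by (simp only:)
      then have "real (ex_co k N F) / N \<le> (ex_co k n F + real (k - 1)) / n + \<eta>"
        using \<eta> k n N F by (intro ex_co_sampling) auto
      also have "\<dots> \<le> real (ex_co k n F) / n + \<epsilon>"
        using n(2) unfolding add_divide_distrib \<eta>_def by linarith
      finally show ?case .
    qed
  qed
qed (rule divide_nonneg_nonneg; simp)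

subsection \<open>The construction\<close>

lemma finite_addresses: "finite (addresses r m)"
  unfolding addresses_def by (rule finite_lists_length_le) simp

lemma card_addresses:
  assumes "k \<ge> 3"
  shows "real (card (addresses (k - 1) m)) = q_const k m"
proof -
  have "real (card (addresses (k - 1) m)) = (\<Sum>i<Suc m. real (k - 1) ^ i)"
    unfolding addresses_def by (simp add: card_lists_length_le lessThan_Suc_atMost)
  also have "\<dots> = (real (k - 1) ^ Suc m - 1) / (real (k - 1) - 1)"
    using assms by (intro geometric_sum) auto
  also have "\<dots> = q_const k m" using assms by (simp add: q_const_def of_nat_diff)
  finally show ?thesis .
qed

text \<open>Transfers the ordering of a host edge to its preimage in \<open>F\<close>, where the
  labels become \<open>\<tau> \<circ> \<phi>\<close>.\<close>

lemma tops_inv_into: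
  assumes "inj_on \<phi> A" "\<phi> ` e = set (v # us)" "e \<subseteq> A" "tops r m \<tau> v us"
  shows "\<exists>v us. e = set (v # us) \<and> tops r m (\<tau> \<circ> \<phi>) v us"
proof -
  define \<psi> where "\<psi> = inv_into A \<phi>"
  have "\<psi> ` \<phi> ` e = e" unfolding \<psi>_def using assms by (intro inv_into_image_cancel)
  then have e: "e = set (\<psi> v # map \<psi> us)" using assms(2) by simp
  have im: "set (v # us) \<subseteq> \<phi> ` A" using assms(2,3) by blast
  then have \<phi>\<psi>: "\<phi> (\<psi> u) = u" if "u \<in> set (v # us)" for u
    unfolding \<psi>_def using that by (intro f_inv_into_f) blast
  have "inj_on \<psi> (set (v # us))" unfolding \<psi>_def by (rule inj_on_inv_into[OF im])
  then have "distinct (map \<psi> (v # us))"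
    using assms(4) by (simp only: distinct_map) (simp add: tops_def)
  then have "tops r m (\<tau> \<circ> \<phi>) (\<psi> v) (map \<psi> us)"
    using assms(4) \<phi>\<psi> by (simp add: tops_def)
  then show ?thesis using e by blast
qed

text \<open>The nodes other than the root use at most \<open>card A - 1\<close> colours. This is why
  as many colours as nodes are provided.\<close>

lemma ex_fresh_label:
  fixes t :: "nat list \<Rightarrow> nat"
  assumes "finite A" "[] \<in> A"
  obtains c where "c < card A" "\<And>p. p \<in> A \<Longrightarrow> p \<noteq> [] \<Longrightarrow> t p \<noteq> c"
proof -
  have "card (t ` (A - {[]})) \<le> card (A - {[]})" using assms by (intro card_image_le) auto
  also have "\<dots> < card {..<card A}" using assms by (simp only: card_lessThan card_Diff1_less)
  finally have "\<not> {..<card A} \<subseteq> t ` (A - {[]})"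
    using assms card_mono[of "t ` (A - {[]})" "{..<card A}"] by (auto simp: not_le)
  then show thesis using that by blast
qed

lemma card_residue_class:
  fixes n Q s :: nat
  assumes "s < Q"
  shows "n div Q \<le> card {v \<in> {..<n}. v mod Q = s}"
proof -
  have "card ((\<lambda>i. i * Q + s) ` {..<n div Q}) = n div Q"
    using assms by (subst card_image) (auto simp: inj_on_def)
  moreover have "(\<lambda>i. i * Q + s) ` {..<n div Q} \<subseteq> {v \<in> {..<n}. v mod Q = s}"
  proof clarsimp
    fix i assume "i < n div Q"
    then have "Suc i * Q \<le> n div Q * Q" by (intro mult_le_mono1) simp
    also have "\<dots> \<le> n" by simp
    finally show "i * Q + s < n \<and> s mod Q = s" using assms by simp
  qed
  ultimately show ?thesis
    using card_mono[of "{v \<in> {..<n}. v mod Q = s}" "(\<lambda>i. i * Q + s) ` {..<n div Q}"] by simp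
qed

lemma ex_co_ge:
  fixes F :: "'a hypergraph"
  assumes k: "k \<ge> 2" "k - 1 \<le> n" and F: "k_graph k F" "\<not> layered F"
    and q: "q = card (addresses (k - 1) (card (verts F)))"
  shows "n div q ^ q - (k - 1) \<le> ex_co k n F"
proof -
  define r where "r = k - 1"
  define m where "m = card (verts F)"
  define A where "A = addresses r m"
  define Q where "Q = q ^ q"
  have A: "finite A" "[] \<in> A" "card A = q"
    by (auto simp: A_def finite_addresses q r_def m_def) (simp add: addresses_def)
  have "finite (PiE A (\<lambda>_. {..<q}))" "card (PiE A (\<lambda>_. {..<q})) = Q"
    using A by (auto intro!: finite_PiE simp: card_PiE Q_def)
  then obtain b where b: "bij_betw b {0..<Q} (PiE A (\<lambda>_. {..<q}))"
    using ex_bij_betw_nat_finite by metis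
  have "q > 0" using A card_gt_0_iff by blast
  then have "Q > 0" by (simp add: Q_def)
  \<comment> \<open>Each label occupies one residue class modulo \<open>Q\<close>, hence at least
    \<open>n div Q\<close> vertices.\<close>
  define \<tau> where "\<tau> v = b (v mod Q)" for v
  have \<tau>: "\<tau> v \<in> PiE A (\<lambda>_. {..<q})" for v
    unfolding \<tau>_def using b \<open>Q > 0\<close> by (intro bij_betwE[OF b, rule_format]) simp
  define H :: "nat hypergraph" where
    "H = ({..<n}, {set (v # us) | v us. set (v # us) \<subseteq> {..<n} \<and> tops r m \<tau> v us})"
  have vH: "verts H = {..<n}"
    and eH: "edges H = {set (v # us) | v us. set (v # us) \<subseteq> {..<n} \<and> tops r m \<tau> v us}"
    by (simp_all add: H_def verts_def edges_def)
  have H: "k_graph k H"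
    unfolding k_graph_def vH eH
  proof (intro conjI ballI)
    fix e assume "e \<in> {set (v # us) | v us. set (v # us) \<subseteq> {..<n} \<and> tops r m \<tau> v us}"
    then obtain v us where e: "e = set (v # us)" "set (v # us) \<subseteq> {..<n}" "tops r m \<tau> v us" by blast
    then show "e \<subseteq> {..<n}" by simp
    have "card (set (v # us)) = length (v # us)"
      using e(3) by (intro distinct_card) (simp add: tops_def)
    then show "card e = k" using e k by (simp add: tops_def r_def)
  qed simp
  have free: "free_of F H"
    unfolding free_of_def
  proof
    assume "\<exists>G. subhypergraph G H \<and> hg_iso F G"
    then obtain G \<phi> where G: "subhypergraph G H" "bij_betw \<phi> (verts F) (verts G)"
      "(\<lambda>e. \<phi> ` e) ` edges F = edges G" by (auto simp: hg_iso_def)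
    have "layered F"
    proof (rule layered_if_tops)
      show "finite (verts F)" "\<And>e. e \<in> edges F \<Longrightarrow> e \<subseteq> verts F"
        using F(1) by (auto simp: k_graph_def)
      fix e assume e: "e \<in> edges F"
      then have "\<phi> ` e \<in> edges H" using G(1,3) by (auto simp: subhypergraph_def)
      then obtain v us where "\<phi> ` e = set (v # us)" "tops r m \<tau> v us" unfolding eH by blast
      then show "\<exists>v us. e = set (v # us) \<and> tops r (card (verts F)) (\<tau> \<circ> \<phi>) v us"
        unfolding m_def using G(2) F(1) e
        by (intro tops_inv_into[where A = "verts F"]) (auto simp: k_graph_def bij_betw_def)
    qed
    with F(2) show False by simp
  qed
  obtain S where S: "S \<subseteq> verts H" "card S = k - 1" "min_codegree k H = hg_degree H S"
    using min_codegree_attained[of H k] k by (auto simp: vH)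
  have finS: "finite S" using S(1) finite_subset by (auto simp: vH)
  define us where "us = sorted_list_of_set S"
  have us: "set us = S" "distinct us" "length us = r"
    using finS S(2) by (simp_all add: us_def r_def)
  \<comment> \<open>The subtrees are prescribed by the vertices of \<open>S\<close>; the root value
    0 is a placeholder, replaced by \<open>c\<close> in \<open>T\<close>.\<close>
  define t where "t p = (case p of [] \<Rightarrow> 0 | i # p' \<Rightarrow> \<tau> (us ! i) p')" for p
  obtain c where c: "c < q" "\<And>p. p \<in> A \<Longrightarrow> p \<noteq> [] \<Longrightarrow> t p \<noteq> c"
    using ex_fresh_label[OF A(1,2), of t] A(3) by metis
  define T where "T = restrict (t([] := c)) A"
  have "t p < q" if p: "p \<in> A" "p \<noteq> []" for p
  proof -
    obtain i p' where ip: "p = i # p'" using p(2) by (cases p) auto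
    then have "p' \<in> A" using p(1) by (auto simp: A_def addresses_def)
    then have "\<tau> (us ! i) p' < q" using \<tau>[of "us ! i"] by (auto simp: PiE_iff)
    then show ?thesis by (simp add: t_def ip)
  qed
  then have "T \<in> PiE A (\<lambda>_. {..<q})" using c(1) by (auto simp: T_def)
  then obtain s where s: "s < Q" "b s = T"
    using bij_betw_imp_surj_on[OF b] by (metis atLeastLessThan_iff imageE)
  have "insert v S \<in> edges H" if v: "v < n" "v mod Q = s" "v \<notin> S" for v
  proof -
    have \<tau>v: "\<tau> v = T" using v s by (simp add: \<tau>_def)
    have "tops r m \<tau> v us"
      unfolding tops_def A_def[symmetric] \<tau>v
      using us v(3) A(2) c(2) by (auto simp: T_def t_def)
    moreover have "insert v S = set (v # us)" "insert v S \<subseteq> {..<n}" using us S(1) v by (auto simp: vH)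
    ultimately show ?thesis unfolding eH by auto
  qed
  then have sub: "{v \<in> {..<n}. v mod Q = s} - S \<subseteq> {v \<in> verts H - S. insert v S \<in> edges H}"
    by (auto simp: vH)
  \<comment> \<open>Vertices of \<open>S\<close> may themselves carry the label \<open>T\<close> but
    cannot complete \<open>S\<close>; at most \<open>k - 1\<close> are lost.\<close>
  have "n div Q - (k - 1) \<le> card {v \<in> {..<n}. v mod Q = s} - card S"
    using card_residue_class[OF s(1), of n] S(2) by simp
  also have "\<dots> \<le> card ({v \<in> {..<n}. v mod Q = s} - S)" using finS by (rule diff_card_le_card_Diff)
  also have "\<dots> \<le> hg_degree H S"
    using sub k hg_degree_eq_card[OF H S(1,2)] by (simp add: card_mono vH)
  also have "\<dots> = min_codegree k H" by (simp add: S(3))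
  also have "\<dots> \<le> ex_co k n F"
    using min_codegree_le_ex_co[OF _ _ H free] k by (simp add: vH)
  finally show ?thesis by (simp add: Q_def)
qed

theorem theorem2:
  fixes k m :: nat and F :: "'a hypergraph"
  assumes "k \<ge> 3"
    and "k_graph k F"
    and "card (verts F) = m"
    and "\<not> layered F"
  shows "pi_co k F \<ge> q_const k m powr (- q_const k m) \<and> q_const k m powr (- q_const k m) > 0"
proof -
  define q where "q = card (addresses (k - 1) m)"
  have q: "real q = q_const k m" using card_addresses assms(1) by (simp add: q_def)
  have "[] \<in> addresses (k - 1) m" by (simp add: addresses_def)
  then have "q > 0" unfolding q_def using finite_addresses card_gt_0_iff by blast
  define Q where "Q = q ^ q"
  have "Q > 0" using \<open>q > 0\<close> by (simp add: Q_def)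
  have powr: "q_const k m powr (- q_const k m) = 1 / Q"
    using \<open>q > 0\<close> by (simp add: q[symmetric] powr_minus powr_realpow Q_def divide_inverse)
  \<comment> \<open>Without edges, \<open>F\<close> would be layered vacuously.\<close>
  have "edges F \<noteq> {}" using assms(4) by (auto simp: layered_def layered_function_def)
  \<comment> \<open>Convergence is what turns \<open>lim\<close> in the definition of
    \<open>pi_co\<close> into a genuine limit.\<close>
  then have lim: "(\<lambda>n. real (ex_co k n F) / n) \<longlonglongrightarrow> pi_co k F"
    unfolding pi_co_def using convergent_ex_co[of k F] assms(1) by (simp add: convergent_LIMSEQ_iff)
  have "(\<lambda>n. 1 / real Q - real k / real n) \<longlonglongrightarrow> 1 / Q" by real_asymp
  \<comment> \<open>The loss \<open>k\<close> consists of the \<open>k - 1\<close> vertices of the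
    set and 1 for rounding \<open>n / Q\<close> down.\<close>
  moreover have "\<forall>n\<ge>k. 1 / real Q - real k / real n \<le> real (ex_co k n F) / n"
  proof (intro allI impI)
    fix n assume n: "n \<ge> k"
    then have "n > 0" using assms(1) by simp
    have "n div Q - (k - 1) \<le> ex_co k n F"
      unfolding Q_def using assms n by (intro ex_co_ge) (auto simp: q_def)
    then have "real (n div Q) \<le> ex_co k n F + (real k - 1)" using assms(1) by linarith
    moreover have "real n / Q < real (n div Q) + 1"
      using floor_correct[of "real n / Q"] by (simp add: floor_divide_of_nat_eq)
    ultimately have "real n / Q - real k \<le> ex_co k n F" by linarith
    then have "(real n / Q - real k) / n \<le> ex_co k n F / n" by (intro divide_right_mono) auto
    then show "1 / real Q - real k / real n \<le> real (ex_co k n F) / n"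
      using \<open>n > 0\<close> by (simp add: diff_divide_distrib)
  qed
  ultimately have "1 / Q \<le> pi_co k F" using lim by (intro LIMSEQ_le) auto
  then show ?thesis using \<open>Q > 0\<close> by (simp add: powr)
qed

end
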